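(* Let $n \ge 1$ be an integer, $\varphi > 0$ a real number with $n\varphi \le \pi$, and let $A, B \in \mathbb{R}^3$ with $A \ne B$. Put $B^{(0)} = A$. Then $$\left(B^{(1)}, \dots, B^{(n)}\right) \in \mathbf{S}^{(n)}(A, B, \varphi) \iff \left(B^{(1)}, \dots, B^{(n)}\right) \in$$ $$\mathbf{S}(A, B, n\varphi) \times \left\{\mathbf{S}\left(B^{(1)}, B, (n-1)\varphi\right) \cap \left[B^{(1)} + \operatorname{cl}\mathbf{C}\left(B^{(1)} - A, \varphi\right)\right]\right\} \times$$ $$\times \left\{\mathbf{S}\left(B^{(2)}, B, (n-2)\varphi\right) \cap \left[B^{(2)} + \operatorname{cl}\mathbf{C}\left(B^{(2)} - B^{(1)}, \varphi\right)\right]\right\} \times \cdots \times$$ $$\times \left\{\mathbf{S}\left(B^{(n-2)}, B, 2\varphi\right) \cap \left[B^{(n-2)} + \operatorname{cl}\mathbf{C}\left(B^{(n-2)} - B^{(n-3)}, \varphi\right)\right]\right\} \times$$ $$\times \left\{\left[\operatorname{cl}\mathbf{S}\left(B^{(n-1)}, B, \varphi\right) \setminus \{A, B\}\right] \cap \left[B^{(n-1)} + \operatorname{cl}\mathbf{C}\left(B^{(n-1)} - B^{(n-2)}, \varphi\right)\right]\right\},$$ where the $k$-th factor of the (dependent) product is the set from which $B^{(k)}$ is taken, and it depends on the previously chosen points. Moreover, for any sequential selection of elements $B^{(1)}, \dots, B^{(n)}$ in accordance with this right-hand side, the set from which the next element of the sequence is chosen is non-empty for any set of preceding terms.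
   Context: Angles: for nonzero $X, Y \in \mathbb{R}^3$, $\angle(X, Y) = \arccos\frac{(X, Y)}{|X||Y|} \in [0, \pi]$, where $(X,Y)$ is the Euclidean inner product; by convention $\angle(X, \mathbf{0}) = \angle(\mathbf{0}, X) = 0$ for every $X \in \mathbb{R}^3$. For $P, Q \in \mathbb{R}^3$, $P \ne Q$, and $\psi \in (0, \pi]$, define $$\mathbf{S}(P, Q, \psi) = \{C \in \mathbb{R}^3 \setminus \{P, Q\} \mid \angle(Q - C, C - P) \in [0, \psi)\},$$ $$\operatorname{cl}\mathbf{S}(P, Q, \psi) = \{C \in \mathbb{R}^3 \mid \angle(Q - C, C - P) \in [0, \psi]\}.$$ For a nonzero vector $E \in \mathbb{R}^3$ and $\psi \in (0, \pi]$, define $$\operatorname{cl}\mathbf{C}(E, \psi) = \{C \in \mathbb{R}^3 \mid \angle(C, E) \in [0, \psi]\}$$ (which contains $\mathbf{0}$). For a point $P$ and a set $X$, $P + X = \{P + x \mid x \in X\}$. $\mathbf{S}^{(n)}(A, B, \varphi)$ is the set of all sequences $\left(B^{(1)}, \dots, B^{(n)}\right)$ of points of $\mathbb{R}^3$ that are the interior vertices of a polygonal chain $\bigcup_{i=0}^{n}\left[B^{(i)}, B^{(i+1)}\right]$ with $B^{(0)} = A$, $B^{(n+1)} = B$, $B^{(i)} \neq B^{(i-1)}$ for $i = 1, \dots, n+1$, and $\angle\left(B^{(i+1)} - B^{(i)}, B^{(i)} - B^{(i-1)}\right) \in [0, \varphi]$ for $i = 1, \dots, n$.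
   Formalization: In the last factor the point B^(n-1) is removed along with A and B; as printed, B^(n) = B^(n-1) would be allowed on the right-hand side for n ≥ 2, although chains in S^(n)(A,B,φ) require consecutive vertices to be distinct. *)

theory Defs
  imports "HOL-Analysis.Analysis"
begin

definition angle :: "real^3 \<Rightarrow> real^3 \<Rightarrow> real" where
  "angle X Y = (if X = 0 \<or> Y = 0 then 0 else arccos ((X \<bullet> Y) / (norm X * norm Y)))"

text \<open>The next two sets are meant for \<open>P \<noteq> Q\<close>, the third one for \<open>E \<noteq> 0\<close>,
  with \<open>\<psi>\<close> in \<open>{0<..pi}\<close>. By the convention on angles with \<open>0\<close>,
  \<open>cl_S P Q \<psi>\<close> contains \<open>P\<close> and \<open>Q\<close>, and \<open>cl_C E \<psi>\<close> contains \<open>0\<close>.\<close>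

definition op_S :: "real^3 \<Rightarrow> real^3 \<Rightarrow> real \<Rightarrow> (real^3) set" where
  "op_S P Q \<psi> = {C. C \<notin> {P, Q} \<and> angle (Q - C) (C - P) \<in> {0..<\<psi>}}"

definition cl_S :: "real^3 \<Rightarrow> real^3 \<Rightarrow> real \<Rightarrow> (real^3) set" where
  "cl_S P Q \<psi> = {C. angle (Q - C) (C - P) \<in> {0..\<psi>}}"

definition cl_C :: "real^3 \<Rightarrow> real \<Rightarrow> (real^3) set" where
  "cl_C E \<psi> = {C. angle C E \<in> {0..\<psi>}}"

text \<open>A sequence \<open>(B\<^sup>(\<^sup>1\<^sup>), \<dots>, B\<^sup>(\<^sup>n\<^sup>))\<close> is a list \<open>bs\<close> of length \<open>n\<close>; with \<open>B\<^sup>(\<^sup>0\<^sup>) = A\<close> and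
  \<open>B\<^sup>(\<^sup>n\<^sup>+\<^sup>1\<^sup>) = B\<close>, the point \<open>B\<^sup>(\<^sup>i\<^sup>)\<close> is \<open>(A # bs @ [B]) ! i\<close>.\<close>

definition chain_seqs :: "nat \<Rightarrow> real^3 \<Rightarrow> real^3 \<Rightarrow> real \<Rightarrow> (real^3) list set" where
  "chain_seqs n A B \<phi> = {bs. length bs = n \<and>
     (let V = (\<lambda>i. (A # bs @ [B]) ! i) in
       (\<forall>i\<in>{1..n+1}. V i \<noteq> V (i - 1)) \<and>
       (\<forall>i\<in>{1..n}. angle (V (i + 1) - V i) (V i - V (i - 1)) \<in> {0..\<phi>}))}"

text \<open>\<open>factor n A B \<phi> ps\<close> is the \<open>k\<close>-th factor of the dependent product, where
  \<open>ps\<close> lists the \<open>k - 1\<close> preceding points. The first factor has no cone condition, and for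
  \<open>n = 1\<close> the only factor is the last one, \<open>cl_S A B \<phi> - {A, B}\<close>.
  In the last factor \<open>B\<^sup>(\<^sup>n\<^sup>-\<^sup>1\<^sup>)\<close> has to be removed explicitly: it belongs to
  \<open>cl_S B\<^sup>(\<^sup>n\<^sup>-\<^sup>1\<^sup>) B \<phi>\<close> and to the shifted cone, whereas consecutive vertices of a
  chain are distinct.\<close>

definition factor :: "nat \<Rightarrow> real^3 \<Rightarrow> real^3 \<Rightarrow> real \<Rightarrow> (real^3) list \<Rightarrow> (real^3) set" where
  "factor n A B \<phi> ps =
     (let k = length ps + 1; V = (\<lambda>i. (A # ps) ! i) in
       (if k < n then op_S (V (k - 1)) B (real (n - k + 1) * \<phi>)
        else cl_S (V (k - 1)) B \<phi> - {A, V (k - 1), B}) \<inter>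
       (if k = 1 then UNIV
        else (\<lambda>x. V (k - 1) + x) ` cl_C (V (k - 1) - V (k - 2)) \<phi>))"

definition selection :: "nat \<Rightarrow> real^3 \<Rightarrow> real^3 \<Rightarrow> real \<Rightarrow> (real^3) list \<Rightarrow> bool" where
  "selection n A B \<phi> ps \<longleftrightarrow>
     (\<forall>k\<in>{1..length ps}. ps ! (k - 1) \<in> factor n A B \<phi> (take (k - 1) ps))"

definition dep_product :: "nat \<Rightarrow> real^3 \<Rightarrow> real^3 \<Rightarrow> real \<Rightarrow> (real^3) list set" where
  "dep_product n A B \<phi> = {bs. length bs = n \<and> selection n A B \<phi> bs}"

end

(* Add the edge vectors of a chain one at a time, starting from the last one. If G is the sum
   of the edges after F, then F + G makes a strictly smaller angle with F than G does (unless
   that angle is 0), so by the triangle inequality for angles the vector from the k-th vertex to B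
   deviates from the k-th edge by at most (n - k + 1) phi, strictly less if k < n; since n phi <= pi, no partial sum
   vanishes. For non-emptiness, rotate the preceding edge by at most phi towards B and take a
   sufficiently short step in this direction: the remaining deviation is continuous in the step
   length, and the strict bound holds in the limit. *)
theory Submission
  imports Defs
begin

section \<open>Angles, their cosines and the triangle inequality\<close>

lemma angle_arg_bounds:
  "(X \<bullet> Y) / (norm X * norm Y) \<in> {-1..1}" for X Y :: "real^3"
proof (cases "X = 0 \<or> Y = 0")
  case False
  then show ?thesis
    using Cauchy_Schwarz_ineq2[of X Y] by (auto simp: field_simps abs_le_iff)
qed auto

lemma angle_nonneg [simp]: "0 \<le> angle X Y"
  using angle_arg_bounds[of X Y] by (auto simp: angle_def intro: arccos_lbound)

lemma angle_self [simp]: "angle X X = 0"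
  by (simp add: angle_def dot_square_norm power2_eq_square)

lemma angle_scaleR:
  assumes "0 < t"
  shows "angle (t *\<^sub>R X) Y = angle X Y" "angle X (t *\<^sub>R Y) = angle X Y"
  using assms by (simp_all add: angle_def)

lemma angle_le_pi: "angle X Y \<le> pi"
  using angle_arg_bounds[of X Y] by (auto simp: angle_def intro: arccos_ubound)

lemma cos_angle:
  "X \<noteq> 0 \<Longrightarrow> Y \<noteq> 0 \<Longrightarrow> cos (angle X Y) = (X \<bullet> Y) / (norm X * norm Y)"
  using angle_arg_bounds[of X Y] by (auto simp: angle_def)

lemma inner_eq_cos_angle: "X \<bullet> Y = norm X * norm Y * cos (angle X Y)"
  by (cases "X = 0 \<or> Y = 0") (auto simp: cos_angle)

text \<open>Cosine decreases strictly on \<open>{0..pi}\<close>, so an angle bound turns into an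
  inequality free of \<open>arccos\<close> and of division; estimates and limits are carried out in
  this form.\<close>

lemma angle_le_iff:
  assumes "X \<noteq> 0" "Y \<noteq> 0" "0 \<le> t" "t \<le> pi"
  shows "angle X Y \<le> t \<longleftrightarrow> norm X * norm Y * cos t \<le> X \<bullet> Y"
proof -
  have "angle X Y \<le> t \<longleftrightarrow> cos t \<le> cos (angle X Y)"
    using assms by (simp add: cos_mono_le_eq angle_le_pi)
  then show ?thesis using assms by (simp add: cos_angle field_simps)
qed

lemma angle_less_iff:
  assumes "X \<noteq> 0" "Y \<noteq> 0" "0 \<le> t" "t \<le> pi"
  shows "angle X Y < t \<longleftrightarrow> norm X * norm Y * cos t < X \<bullet> Y"
proof -
  have "angle X Y < t \<longleftrightarrow> cos t < cos (angle X Y)"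
    using assms by (simp add: cos_mono_less_eq angle_le_pi)
  then show ?thesis using assms by (simp add: cos_angle field_simps)
qed

text \<open>Split the unit vectors \<open>x\<close> and \<open>z\<close> into their parts along
  \<open>y\<close> and orthogonal to \<open>y\<close>. The orthogonal parts have lengths
  \<open>sin a\<close> and \<open>sin b\<close>, so Cauchy-Schwarz gives \<open>x \<bullet> z \<ge>
  cos a * cos b - sin a * sin b = cos (a + b)\<close>. For \<open>Y = 0\<close> the convention would
  make the right side 0.\<close>

lemma angle_triangle:
  assumes "Y \<noteq> 0"
  shows "angle X Z \<le> angle X Y + angle Y Z"
\<comment> \<open>By convention the left side is 0 if \<open>X\<close> or \<open>Z\<close> is 0, and
  no angle exceeds \<open>pi\<close>; what remains is the range in which \<open>angle_le_iff\<close>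
  applies to \<open>a + b\<close>.\<close>
proof (cases "X = 0 \<or> Z = 0 \<or> angle X Y + angle Y Z > pi")
  case True
  then show ?thesis
  proof (elim disjE)
    assume "angle X Y + angle Y Z > pi"
    then show ?thesis using angle_le_pi[of X Z] by linarith
  qed (auto simp: angle_def[of 0] angle_def[of _ 0])
next
  case False
  define a b where "a = angle X Y" and "b = angle Y Z"
  define x y z where "x = X /\<^sub>R norm X" and "y = Y /\<^sub>R norm Y" and "z = Z /\<^sub>R norm Z"
  have n: "x \<bullet> x = 1" "y \<bullet> y = 1" "z \<bullet> z = 1"
    using False assms by (auto simp: x_def y_def z_def dot_square_norm power2_eq_square field_simps)
  have xy: "x \<bullet> y = cos a" "y \<bullet> z = cos b"
    using False assms by (auto simp: x_def y_def z_def a_def b_def cos_angle field_simps)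
  have "(norm (x - cos a *\<^sub>R y))\<^sup>2 = (sin a)\<^sup>2"
    by (simp add: power2_norm_eq_inner inner_diff inner_commute n xy sin_squared_eq
        power2_eq_square[of "cos a"] inner_commute[of y x])
  moreover have "sin a \<ge> 0" using angle_le_pi[of X Y] by (simp add: a_def sin_ge_zero)
  ultimately have na: "norm (x - cos a *\<^sub>R y) = sin a" by simp
  have "(norm (z - cos b *\<^sub>R y))\<^sup>2 = (sin b)\<^sup>2"
    by (simp add: power2_norm_eq_inner inner_diff n xy sin_squared_eq
        power2_eq_square[of "cos b"] inner_commute[of z y])
  moreover have "sin b \<ge> 0" using angle_le_pi[of Y Z] by (simp add: b_def sin_ge_zero)
  ultimately have nb: "norm (z - cos b *\<^sub>R y) = sin b" by simp
  have "(x - cos a *\<^sub>R y) \<bullet> (z - cos b *\<^sub>R y) = x \<bullet> z - cos a * cos b"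
    by (simp add: inner_diff n xy)
  then have "cos (a + b) \<le> x \<bullet> z"
    using Cauchy_Schwarz_ineq2[of "x - cos a *\<^sub>R y" "z - cos b *\<^sub>R y"]
    by (simp add: na nb cos_add)
  then have "norm X * norm Z * cos (a + b) \<le> X \<bullet> Z"
    using False by (simp add: x_def z_def field_simps)
  then show ?thesis
    using False by (simp add: angle_le_iff a_def b_def)
qed

section \<open>Sums of consecutive edges of a chain\<close>

lemma add_nonzero_of_angle_less_pi:
  assumes "F \<noteq> 0" "angle G F < pi"
  shows "F + G \<noteq> 0"
proof
  assume "F + G = 0"
  then have "G = - F" by (simp add: add_eq_0_iff)
  with assms show False
    by (simp add: angle_def dot_square_norm power2_eq_square)
qed

text \<open>With \<open>c\<close> the cosine of the angle between \<open>G\<close> and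
  \<open>F\<close>, a strict decrease of the angle amounts to
  \<open>c * (norm (F + G) - norm G) < norm F\<close>. A positive bound \<open>M\<close> keeps the
  conclusion strict also when the angle is 0 and cannot decrease.\<close>

lemma angle_add_less:
  assumes "F \<noteq> 0" "G \<noteq> 0" "angle G F < pi" "angle G F \<le> M" "0 < M"
  shows "angle (F + G) F < M"
proof -
  define c where "c = cos (angle G F)"
  have ne: "F + G \<noteq> 0" using assms add_nonzero_of_angle_less_pi by blast
  have GF: "G \<bullet> F = norm G * norm F * c" by (simp add: c_def inner_eq_cos_angle)
  have FGF: "(F + G) \<bullet> F = norm F * (norm F + norm G * c)"
    by (simp add: inner_add_left GF dot_square_norm power2_eq_square algebra_simps)
  show ?thesis
  proof (cases "angle G F = 0")
    case True
    \<comment> \<open>Here \<open>c = 1\<close>, and the bound at angle 0 is just the triangle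
      inequality for norms.\<close>
    have "angle (F + G) F \<le> 0"
      using ne assms FGF True norm_triangle_ineq[of F G]
      by (simp add: angle_le_iff c_def mult.commute)
    then show ?thesis using assms by linarith
  next
    case False
    then have "cos pi < c" "c < cos 0"
      unfolding c_def using assms(3) angle_nonneg[of G F]
      by (intro cos_monotone_0_pi; linarith)+
    then have "\<bar>c\<bar> < 1" by auto
    have "\<bar>norm (F + G) - norm G\<bar> \<le> norm F"
      using norm_triangle_ineq3[of "F + G" G] by simp
    then have "\<bar>c\<bar> * \<bar>norm (F + G) - norm G\<bar> \<le> \<bar>c\<bar> * norm F"
      by (simp add: mult_left_mono)
    also have "\<dots> < norm F" using \<open>\<bar>c\<bar> < 1\<close> assms by simp
    finally have "c * (norm (F + G) - norm G) < norm F"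
      by (metis abs_mult abs_ge_self le_less_trans)
    then have "norm (F + G) * c < norm F + norm G * c"
      by (simp add: algebra_simps)
    then have "norm F * (norm (F + G) * c) < norm F * (norm F + norm G * c)"
      using assms(1) by (intro mult_strict_left_mono) auto
    then have "angle (F + G) F < angle G F"
      using ne assms FGF by (simp add: angle_less_iff angle_le_pi c_def mult_ac)
    then show ?thesis using assms by linarith
  qed
qed

text \<open>The three claims support each other in a downward induction on \<open>k\<close>: the
  remainder must be nonzero for its angle to carry information, and only the weak bound holds at
  \<open>k = n\<close>, where it is the last angle condition of the chain.\<close>

lemma chain_remainder:
  fixes V :: "nat \<Rightarrow> real^3"
  assumes ne: "\<And>i. i \<in> {1..n+1} \<Longrightarrow> V i \<noteq> V (i - 1)"
    and ang: "\<And>i. i \<in> {1..n} \<Longrightarrow> angle (V (i + 1) - V i) (V i - V (i - 1)) \<le> \<phi>"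
    and pos: "0 < \<phi>" and le: "real n * \<phi> \<le> pi" and k: "1 \<le> k" "k \<le> n"
  shows "V (n + 1) \<noteq> V k \<and>
    angle (V (n + 1) - V k) (V k - V (k - 1)) \<le> real (n - k + 1) * \<phi> \<and>
    (k < n \<longrightarrow> angle (V (n + 1) - V k) (V k - V (k - 1)) < real (n - k + 1) * \<phi>)"
  using k(2,1)
proof (induction rule: inc_induct)
  case base
  then show ?case using ne[of "n + 1"] ang[of n] by simp
next
  case (step j)
  define F G where "F = V (Suc j) - V j" and "G = V (n + 1) - V (Suc j)"
  define M where "M = real (n - j) * \<phi>"
  have FG: "F \<noteq> 0" "G \<noteq> 0" using step ne[of "Suc j"] by (auto simp: F_def G_def)
  have M: "angle G F \<le> M"
    using step by (simp add: F_def G_def M_def Suc_diff_Suc del: of_nat_Suc)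
  have M0: "0 < M" using step pos by (simp add: M_def)
  \<comment> \<open>Strict because \<open>j \<ge> 1\<close>; hence the angle stays below
    \<open>pi\<close> even if \<open>n * \<phi>\<close> equals \<open>pi\<close>.\<close>
  have "M < real n * \<phi>" using step pos by (simp add: M_def)
  then have lt: "angle G F < pi" using M le by linarith
  have sum: "F + G = V (n + 1) - V j" by (simp add: F_def G_def)
  have "angle (F + G) (V j - V (j - 1)) \<le> angle (F + G) F + angle F (V j - V (j - 1))"
    using FG angle_triangle by blast
  also have "\<dots> < M + \<phi>"
    using angle_add_less[OF FG lt M M0] ang[of j] step by (simp add: F_def)
  also have "\<dots> = real (n - j + 1) * \<phi>" by (simp add: M_def algebra_simps)
  finally have "angle (V (n + 1) - V j) (V j - V (j - 1)) < real (n - j + 1) * \<phi>"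
    by (simp only: sum)
  moreover have "V (n + 1) \<noteq> V j"
    using add_nonzero_of_angle_less_pi[OF FG(1) lt] sum by auto
  ultimately show ?case by auto
qed

text \<open>The part after the first edge makes an angle below \<open>pi\<close> with that edge and
  so cannot cancel it. Applied to a chain without its last edge, this shows that the last interior
  vertex differs from \<open>A\<close>.\<close>

lemma chain_not_closed:
  fixes V :: "nat \<Rightarrow> real^3"
  assumes "\<And>i. i \<in> {1..n+1} \<Longrightarrow> V i \<noteq> V (i - 1)"
    and "\<And>i. i \<in> {1..n} \<Longrightarrow> angle (V (i + 1) - V i) (V i - V (i - 1)) \<le> \<phi>"
    and "0 < \<phi>" and "real n * \<phi> < pi"
  shows "V (n + 1) \<noteq> V 0"
proof (cases "n = 0")
  case False
  then have "angle (V (n + 1) - V 1) (V 1 - V 0) \<le> real n * \<phi>"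
    using chain_remainder[of n V \<phi> 1] assms by simp
  moreover have "V 1 - V 0 \<noteq> 0" using assms(1)[of 1] by simp
  ultimately have "(V 1 - V 0) + (V (n + 1) - V 1) \<noteq> 0"
    using assms(4) by (intro add_nonzero_of_angle_less_pi) auto
  then show ?thesis by auto
qed (use assms(1)[of 1] in auto)

section \<open>Construction of a next edge\<close>

lemma exists_intermediate_direction:
  assumes "G \<noteq> 0" "E \<noteq> 0" "0 < \<phi>" "0 < M" "angle G E < M + \<phi>" "M + \<phi> \<le> pi"
  shows "\<exists>U. U \<noteq> 0 \<and> angle U E \<le> \<phi> \<and> angle G U < M"
proof (cases "angle G E \<le> \<phi>")
  \<comment> \<open>Turning by at most \<open>\<phi>\<close> already reaches the direction of
    \<open>G\<close>.\<close>
  case True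
  then show ?thesis using assms by (intro exI[of _ G]) simp
next
  case False
  define a where "a = angle G E"
  define g e where "g = G /\<^sub>R norm G" and "e = E /\<^sub>R norm E"
  \<comment> \<open>\<open>e\<close> and \<open>w\<close> form an orthonormal basis of the plane of
    \<open>E\<close> and \<open>G\<close>, with \<open>g\<close> at angle \<open>a\<close> from
    \<open>e\<close>; \<open>U\<close> is \<open>e\<close> turned by \<open>\<phi>\<close> towards
    \<open>g\<close>, leaving the angle \<open>a - \<phi> < M\<close>.\<close>
  define w where "w = (g - cos a *\<^sub>R e) /\<^sub>R sin a"
  define U where "U = cos \<phi> *\<^sub>R e + sin \<phi> *\<^sub>R w"
  have a: "\<phi> < a" "a < M + \<phi>" "a < pi" using False assms by (auto simp: a_def)
  then have s: "sin a > 0" using assms by (simp add: sin_gt_zero)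
  have n: "g \<bullet> g = 1" "e \<bullet> e = 1"
    using assms by (auto simp: g_def e_def dot_square_norm power2_eq_square field_simps)
  have ge: "g \<bullet> e = cos a" "e \<bullet> g = cos a"
    using assms by (auto simp: g_def e_def a_def cos_angle field_simps inner_commute)
  have we: "w \<bullet> e = 0" "e \<bullet> w = 0" by (simp_all add: w_def inner_diff n ge)
  have "(g - cos a *\<^sub>R e) \<bullet> (g - cos a *\<^sub>R e) = (sin a)\<^sup>2"
    by (simp add: inner_diff n ge sin_squared_eq power2_eq_square[of "cos a"])
  moreover have "w \<bullet> w = ((g - cos a *\<^sub>R e) \<bullet> (g - cos a *\<^sub>R e)) / (sin a)\<^sup>2"
    by (simp add: w_def power2_eq_square divide_inverse)
  ultimately have ww: "w \<bullet> w = 1" using s by simp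
  have g: "g = cos a *\<^sub>R e + sin a *\<^sub>R w" using s by (simp add: w_def)
  have "U \<bullet> U = (cos \<phi>)\<^sup>2 + (sin \<phi>)\<^sup>2"
    by (simp add: U_def inner_add we ww n power2_eq_square)
  then have nU: "norm U = 1" by (simp add: norm_eq_sqrt_inner)
  then have U0: "U \<noteq> 0" by auto
  have "U \<bullet> e = cos \<phi>" by (simp add: U_def inner_add we n)
  then have UE: "U \<bullet> E = norm E * cos \<phi>" using assms by (simp add: e_def field_simps)
  have "g \<bullet> U = cos (a - \<phi>)"
    by (simp add: g U_def inner_add we n ww cos_diff)
  then have "G \<bullet> U = norm G * cos (a - \<phi>)" using assms by (simp add: g_def field_simps)
  then have "angle G U \<le> a - \<phi>" using U0 assms a nU by (simp add: angle_le_iff)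
  moreover have "angle U E \<le> \<phi>" using U0 assms nU UE by (simp add: angle_le_iff)
  ultimately show ?thesis using U0 a by (intro exI[of _ U]) auto
qed

text \<open>Everything is relative to the current vertex: \<open>G\<close> leads to
  \<open>B\<close>, \<open>E\<close> is the preceding edge and \<open>X\<close> the next one.
  \<open>D\<close> is one more forbidden step, needed to keep the last interior vertex away from
  \<open>A\<close>.\<close>

lemma exists_next_vertex:
  fixes D :: "real^3"
  assumes "G \<noteq> 0" "E \<noteq> 0" "0 < \<phi>" "0 < M" "angle G E < M + \<phi>" "M + \<phi> \<le> pi"
  shows "\<exists>X. X \<noteq> 0 \<and> X \<noteq> G \<and> X \<noteq> D \<and> angle X E \<le> \<phi> \<and> angle (G - X) X < M"
proof -
  obtain U where U: "U \<noteq> 0" "angle U E \<le> \<phi>" "angle G U < M"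
    using exists_intermediate_direction[OF assms] by blast
  have M: "M \<le> pi" "0 \<le> M" using assms by auto
  have tU: "((\<lambda>t. t *\<^sub>R U) \<longlongrightarrow> 0) (at_right 0)" for U :: "real^3"
    by (auto intro!: tendsto_eq_intros)
  have lim: "((\<lambda>t. G - t *\<^sub>R U) \<longlongrightarrow> G) (at_right 0)"
    by (auto intro!: tendsto_eq_intros)
  \<comment> \<open>The direction \<open>U\<close> replaces the step \<open>t *\<^sub>R U\<close>,
    which vanishes in the limit; positive scaling does not change the angle. At \<open>t = 0\<close>
    the expression is positive since \<open>angle G U < M\<close>.\<close>
  have "((\<lambda>t. (G - t *\<^sub>R U) \<bullet> U - norm (G - t *\<^sub>R U) * norm U * cos M)
      \<longlongrightarrow> G \<bullet> U - norm G * norm U * cos M) (at_right 0)"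
    by (intro tendsto_intros lim)
  moreover have "G \<bullet> U - norm G * norm U * cos M > 0"
    using U M assms by (simp add: angle_less_iff)
  ultimately have ev1: "\<forall>\<^sub>F t in at_right 0. (G - t *\<^sub>R U) \<bullet> U - norm (G - t *\<^sub>R U) * norm U * cos M > 0"
    by (rule order_tendstoD)
  have ev2: "\<forall>\<^sub>F t in at_right 0. G - t *\<^sub>R U \<noteq> 0"
    using lim assms(1) by (rule tendsto_imp_eventually_ne)
  have ev3: "\<forall>\<^sub>F t in at_right (0::real). t *\<^sub>R U \<noteq> D"
  proof (cases "D = 0")
    case True
    then show ?thesis using U by (auto simp: eventually_at_filter)
  next
    case False
    then show ?thesis using tendsto_imp_eventually_ne[OF tU] by metis
  qed
  have "\<forall>\<^sub>F t in at_right (0::real). t > 0" by (simp add: eventually_at_right_less)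
  with ev1 ev2 ev3 have "\<forall>\<^sub>F t in at_right (0::real). t > 0 \<and> G - t *\<^sub>R U \<noteq> 0 \<and> t *\<^sub>R U \<noteq> D \<and>
      (G - t *\<^sub>R U) \<bullet> U - norm (G - t *\<^sub>R U) * norm U * cos M > 0"
    by eventually_elim auto
  from eventually_happens'[OF trivial_limit_at_right_real this] obtain t where t: "t > 0" "G - t *\<^sub>R U \<noteq> 0" "t *\<^sub>R U \<noteq> D"
      "(G - t *\<^sub>R U) \<bullet> U > norm (G - t *\<^sub>R U) * norm U * cos M"
    by auto
  have "angle (G - t *\<^sub>R U) U < M" using t U M by (simp add: angle_less_iff)
  then have "angle (G - t *\<^sub>R U) (t *\<^sub>R U) < M"
    using t(1) by (simp add: angle_scaleR)
  moreover have "angle (t *\<^sub>R U) E \<le> \<phi>" using t(1) U by (simp add: angle_scaleR)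
  ultimately show ?thesis using t U by (intro exI[of _ "t *\<^sub>R U"]) auto
qed

section \<open>Membership in the factors, and the equivalence\<close>

lemma mem_translate_cl_C:
  "x \<in> (\<lambda>y. P + y) ` cl_C E \<psi> \<longleftrightarrow> angle (x - P) E \<le> \<psi>"
  by (auto simp: cl_C_def image_iff intro: bexI[of _ "x - P"])

text \<open>Rewrites a factor in the vertex indexing of chains. The case
  \<open>k = length bs + 1\<close> covers a point not yet chosen.\<close>

lemma mem_factor_take:
  fixes A B :: "real^3"
  assumes "1 \<le> k" "k \<le> length bs + 1"
  defines "V \<equiv> (\<lambda>i. (A # bs @ [B]) ! i)"
  shows "x \<in> factor n A B \<phi> (take (k - 1) bs) \<longleftrightarrow>
    (if k < n then x \<noteq> V (k - 1) \<and> x \<noteq> B \<and> angle (B - x) (x - V (k - 1)) < real (n - k + 1) * \<phi>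
     else x \<noteq> A \<and> x \<noteq> V (k - 1) \<and> x \<noteq> B \<and> angle (B - x) (x - V (k - 1)) \<le> \<phi>) \<and>
    (k = 1 \<or> angle (x - V (k - 1)) (V (k - 1) - V (k - 2)) \<le> \<phi>)"
proof -
  have l: "length (take (k - 1) bs) + 1 = k" using assms by simp
  have v: "(A # take (k - 1) bs) ! i = V i" if "i < k" for i
    using that assms by (cases i) (auto simp: V_def nth_append)
  \<comment> \<open>For \<open>k = 1\<close> the index \<open>k - 2\<close> truncates to 0, still
    below \<open>k\<close>.\<close>
  have "(A # take (k - 1) bs) ! (k - 1) = V (k - 1)" "(A # take (k - 1) bs) ! (k - 2) = V (k - 2)"
    by (rule v; use assms(1) in simp)+
  then show ?thesis
    unfolding factor_def Let_def l
    by (simp only:) (auto simp: mem_translate_cl_C op_S_def cl_S_def)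
qed

text \<open>The cone condition of factor \<open>k\<close> is the chain's angle condition at vertex
  \<open>k - 1\<close>, and the closed set in factor \<open>n\<close> supplies the one at vertex
  \<open>n\<close>. The open sets in the earlier factors are consequences, through
  \<open>chain_remainder\<close>.\<close>

lemma chain_seqs_eq_dep_product:
  assumes "n \<ge> 1" "\<phi> > 0" "real n * \<phi> \<le> pi"
  shows "chain_seqs n A B \<phi> = dep_product n A B \<phi>"
proof (intro set_eqI)
  fix bs :: "(real^3) list"
  define V where "V = (\<lambda>i. (A # bs @ [B]) ! i)"
  have fac: "bs ! (k - 1) \<in> factor n A B \<phi> (take (k - 1) bs) \<longleftrightarrow>
    (if k < n then V k \<noteq> V (k - 1) \<and> V k \<noteq> B \<and> angle (B - V k) (V k - V (k - 1)) < real (n - k + 1) * \<phi>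
     else V k \<noteq> A \<and> V k \<noteq> V (k - 1) \<and> V k \<noteq> B \<and> angle (B - V k) (V k - V (k - 1)) \<le> \<phi>) \<and>
    (k = 1 \<or> angle (V k - V (k - 1)) (V (k - 1) - V (k - 2)) \<le> \<phi>)"
    if "length bs = n" "k \<in> {1..n}" for k
  proof -
    have "bs ! (k - 1) = V k" using that by (cases k) (auto simp: V_def nth_append)
    then show ?thesis using mem_factor_take[of k bs] that unfolding V_def by simp
  qed
  have V0: "V 0 = A" by (simp add: V_def)
  have Vn: "V (n + 1) = B" if "length bs = n" using that by (auto simp: V_def nth_append)
  show "bs \<in> chain_seqs n A B \<phi> \<longleftrightarrow> bs \<in> dep_product n A B \<phi>"
  proof
    assume "bs \<in> chain_seqs n A B \<phi>"
    then have len: "length bs = n"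
      and ne: "\<And>i. i \<in> {1..n+1} \<Longrightarrow> V i \<noteq> V (i - 1)"
      and ang: "\<And>i. i \<in> {1..n} \<Longrightarrow> angle (V (i + 1) - V i) (V i - V (i - 1)) \<le> \<phi>"
      unfolding chain_seqs_def V_def Let_def by auto
    have "bs ! (k - 1) \<in> factor n A B \<phi> (take (k - 1) bs)" if k: "k \<in> {1..n}" for k
    proof -
      have rem: "B \<noteq> V k" "angle (B - V k) (V k - V (k - 1)) \<le> real (n - k + 1) * \<phi>"
        "k < n \<Longrightarrow> angle (B - V k) (V k - V (k - 1)) < real (n - k + 1) * \<phi>"
        using chain_remainder[OF ne ang assms(2,3), of k] k Vn[OF len] by auto
      \<comment> \<open>The last factor excludes \<open>A\<close>. Dropping the last edge leaves a
        chain with \<open>n - 1\<close> interior vertices, and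
        \<open>(n - 1) * \<phi> < pi\<close>.\<close>
      have "V n \<noteq> A"
      proof -
        have "real (n - 1) * \<phi> < real n * \<phi>" using assms(1,2) by simp
        then have "V (n - 1 + 1) \<noteq> V 0"
          using assms(2,3) by (intro chain_not_closed[where \<phi> = \<phi>] ne ang; (linarith | auto))
        then show ?thesis using assms(1) V0 by simp
      qed
      moreover have "angle (V k - V (k - 1)) (V (k - 1) - V (k - 2)) \<le> \<phi>" if "k \<noteq> 1"
      proof -
        have "k - 1 \<in> {1..n}" "k - 1 + 1 = k" "k - 1 - 1 = k - 2" using k that by auto
        then show ?thesis using ang[of "k - 1"] by simp
      qed
      ultimately show ?thesis
        unfolding fac[OF len k] using rem ne[of k] k by (cases "k = n") auto
    qed
    then show "bs \<in> dep_product n A B \<phi>"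
      by (auto simp: dep_product_def selection_def len)
  next
    assume "bs \<in> dep_product n A B \<phi>"
    then have len: "length bs = n"
      and sel: "\<And>k. k \<in> {1..n} \<Longrightarrow> bs ! (k - 1) \<in> factor n A B \<phi> (take (k - 1) bs)"
      by (auto simp: dep_product_def selection_def)
    note f = iffD1[OF fac[OF len] sel]
    have "V i \<noteq> V (i - 1)" if "i \<in> {1..n+1}" for i
      \<comment> \<open>The last edge, \<open>i = n + 1\<close>, is nonzero because factor
        \<open>n\<close> excludes \<open>B\<close>.\<close>
      using f[of i] f[of n] assms(1) that Vn[OF len]
      by (cases "i = n + 1") (auto split: if_splits)
    moreover have "angle (V (i + 1) - V i) (V i - V (i - 1)) \<le> \<phi>" if "i \<in> {1..n}" for i
      using f[of "i + 1"] f[of n] that Vn[OF len] by (cases "i = n") auto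
    ultimately show "bs \<in> chain_seqs n A B \<phi>"
      using len unfolding chain_seqs_def V_def Let_def by auto
  qed
qed

section \<open>Non-emptiness of the factors\<close>

lemma factor_nonempty:
  assumes "\<phi> > 0" "real n * \<phi> \<le> pi" "A \<noteq> B" "length ps < n" "selection n A B \<phi> ps"
  shows "factor n A B \<phi> ps \<noteq> {}"
proof -
  define V where "V = (\<lambda>i. (A # ps @ [B]) ! i)"
  define k where "k = length ps + 1"
  have k: "1 \<le> k" "k \<le> n" "k \<le> length ps + 1" "take (k - 1) ps = ps"
    using assms by (auto simp: k_def)
  note mem = mem_factor_take[OF k(1,3), where A = A and B = B and n = n and \<phi> = \<phi>,
      unfolded k(4), folded V_def]
  have V0: "V 0 = A" by (simp add: V_def)
  show ?thesis
  proof (cases "k = 1")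
    case True
    \<comment> \<open>Both halves of the segment are the same vector, so its midpoint has angle 0
      and serves whether or not the first factor is also the last.\<close>
    have "B - midpoint A B = midpoint A B - A" by (simp add: midpoint_def algebra_simps flip: scaleR_add_left)
    then have "angle (B - midpoint A B) (midpoint A B - A) = 0"
      by (simp only: angle_self)
    then have "midpoint A B \<in> factor n A B \<phi> ps"
      unfolding mem using True assms V0 by auto
    then show ?thesis by blast
  next
    case False
    \<comment> \<open>\<open>j\<close> is the index of the last chosen vertex. As
      \<open>j < n\<close>, it was taken from an open set, which gives the strict bound needed to
      continue.\<close>
    define j where "j = k - 1"
    have j: "1 \<le> j" "j < n" "j \<le> length ps" using False k by (auto simp: j_def)
    have "ps ! (j - 1) \<in> factor n A B \<phi> (take (j - 1) ps)"
      using assms(5) j by (auto simp: selection_def)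
    moreover have "ps ! (j - 1) = V j" using j by (cases j) (auto simp: V_def nth_append)
    ultimately have prev: "V j \<noteq> V (j - 1)" "V j \<noteq> B"
      "angle (B - V j) (V j - V (j - 1)) < real (n - j + 1) * \<phi>"
      using mem_factor_take[of j ps "V j" n A B \<phi>] j unfolding V_def by auto
    define M where "M = real (n - j) * \<phi>"
    have M: "0 < M" "M + \<phi> = real (n - j + 1) * \<phi>"
      using assms(1) j by (auto simp: M_def algebra_simps)
    have "real (n - j + 1) * \<phi> \<le> real n * \<phi>" using assms(1) j by (intro mult_right_mono) auto
    then have "M + \<phi> \<le> pi" using M assms(2) by linarith
    then obtain X where X: "X \<noteq> 0" "X \<noteq> B - V j" "X \<noteq> A - V j"
        "angle X (V j - V (j - 1)) \<le> \<phi>" "angle (B - V j - X) X < M"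
      using exists_next_vertex[of "B - V j" "V j - V (j - 1)" \<phi> M "A - V j"] prev M assms(1) by auto
    have kj: "k - 1 = j" "k - 2 = j - 1" "n - k + 1 = n - j" using j k by (auto simp: j_def)
    \<comment> \<open>In the last factor the bound \<open>M\<close> is \<open>\<phi>\<close> itself,
      so the strict inequality for \<open>X\<close> places the new vertex in the closed set.\<close>
    have "M = \<phi>" if "\<not> k < n"
    proof -
      have "n - j = 1" using that k kj(3) by simp
      then show ?thesis unfolding M_def by simp
    qed
    moreover have "V j + X \<noteq> A" "V j + X \<noteq> B"
      using X(2,3) by auto
    ultimately have "V j + X \<in> factor n A B \<phi> ps"
      unfolding mem kj using X M_def by (auto simp: diff_diff_eq)
    then show ?thesis by blast
  qed
qed

theorem theorem2:
  fixes n :: nat and \<phi> :: real and A B :: "real^3"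
  assumes "n \<ge> 1" and "\<phi> > 0" and "real n * \<phi> \<le> pi" and "A \<noteq> B"
  shows "(\<forall>bs. bs \<in> chain_seqs n A B \<phi> \<longleftrightarrow> bs \<in> dep_product n A B \<phi>) \<and>
         (\<forall>ps. length ps < n \<and> selection n A B \<phi> ps \<longrightarrow> factor n A B \<phi> ps \<noteq> {})"
  using chain_seqs_eq_dep_product[OF assms(1-3)] factor_nonempty[OF assms(2-4)] by blast

end
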